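(* Let $Q$ be the graph with vertex set $\{0,1\}^2=\{00,01,10,11\}$ whose edge set is $\{\{01,00\},\{01,10\},\{01,11\}\}$ (all three edges incident to $01$). Then $$C_M(Q)=\log_2\frac{1+\sqrt5}{2}.$$
   Context: Let $G$ be a simple graph with vertex set $\{0,1\}^2$, the set of ordered pairs of binary symbols (written as strings $ab$), whose edges are unordered pairs of distinct vertices. Two sequences $\mathbf{x}=(x_1,\dots,x_n),\mathbf{y}=(y_1,\dots,y_n)\in\{0,1\}^n$ are called distinguishable for $G$ if there exists $i\in\{1,\dots,n-1\}$ such that $\{x_ix_{i+1},\,y_iy_{i+1}\}$ is an edge of $G$. Let $M(G,n)$ be the largest cardinality of a set $C\subseteq\{0,1\}^n$ any two distinct elements of which are distinguishable for $G$. The Shannon–Markov capacity of $G$ is $C_M(G)=\limsup_{n\to\infty}\frac1n\log_2 M(G,n)$. *)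

theory Defs
  imports Complex_Main "HOL-Library.Extended_Real"
begin

text \<open>The binary symbols 0 and 1 are \<^const>\<open>False\<close> and \<^const>\<open>True\<close>. A graph on the
  vertex set \<open>{0,1}\<^sup>2\<close> is given by its set of edges, each edge being a two-element set.\<close>

type_synonym vertex = "bool \<times> bool"

definition simple_graph :: "vertex set set \<Rightarrow> bool" where
  "simple_graph G \<longleftrightarrow> (\<forall>e\<in>G. card e = 2)"

text \<open>List positions are counted from 0, so \<open>i\<close> here is \<open>i + 1\<close> in the usual numbering
  \<open>x\<^sub>1, \<dots>, x\<^sub>n\<close>. The relation is only used for lists of equal length.\<close>

definition distinguishable :: "vertex set set \<Rightarrow> bool list \<Rightarrow> bool list \<Rightarrow> bool" where
  "distinguishable G x y \<longleftrightarrow>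
     (\<exists>i. Suc i < length x \<and> {(x ! i, x ! Suc i), (y ! i, y ! Suc i)} \<in> G)"

definition max_distinguishable :: "vertex set set \<Rightarrow> nat \<Rightarrow> nat" where
  "max_distinguishable G n =
     Max {card C | C. C \<subseteq> {x. length x = n} \<and> pairwise (distinguishable G) C}"

text \<open>The limit superior is taken in the extended reals, where it always exists. The value at
  \<open>n = 0\<close> has no influence on it.\<close>

definition shannon_markov_capacity :: "vertex set set \<Rightarrow> ereal" where
  "shannon_markov_capacity G =
     limsup (\<lambda>n. ereal (1 / real n * log 2 (real (max_distinguishable G n))))"

definition Q :: "vertex set set" where
  "Q = {{(False, True), (False, False)},
        {(False, True), (True, False)},
        {(False, True), (True, True)}}"

lemma simple_graph_Q: "simple_graph Q"
  by (simp add: simple_graph_def Q_def)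

text \<open>The maximum ranges over a finite nonempty set.\<close>

lemma finite_distinguishable_cards:
  "finite {card C | C. C \<subseteq> {x. length x = n} \<and> pairwise (distinguishable G) C}"
proof -
  have "finite {x :: bool list. length x = n}"
    using finite_lists_length_eq[of "UNIV :: bool set" n] by simp
  then have "finite (card ` Pow {x :: bool list. length x = n})"
    by simp
  then show ?thesis
    by (rule rev_finite_subset) auto
qed

lemma distinguishable_cards_nonempty:
  "{card C | C. C \<subseteq> {x. length x = n} \<and> pairwise (distinguishable G) C} \<noteq> {}"
  using pairwise_empty by blast

end

theory Submission
  imports Defs "HOL-Number_Theory.Fib"
begin

text \<open>
  Since every edge of \<open>Q\<close> contains \<open>01\<close> and \<open>01\<close> is adjacent to everything else, two words are
  distinguishable precisely when the sets of positions at which \<open>01\<close> occurs differ. The occurrence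
  sets of words of length \<open>n\<close> are exactly the subsets of the first \<open>n - 1\<close> positions without two
  consecutive elements, so \<open>M(Q, n)\<close> is the Fibonacci number \<open>F\<^sub>n\<^sub>+\<^sub>1\<close>, which grows like the powers
  of the golden ratio.
\<close>

definition rise_positions :: "bool list \<Rightarrow> nat set" where
  "rise_positions x = {i. Suc i < length x \<and> \<not> x ! i \<and> x ! Suc i}"

definition sparse_sets :: "nat \<Rightarrow> nat set set" where
  "sparse_sets n = {A. \<forall>i\<in>A. Suc i < n \<and> Suc i \<notin> A}"

text \<open>A right inverse of \<open>rise_positions\<close> on sparse sets: a 1 is placed just
  after each element of \<open>A\<close> and 0 everywhere else.\<close>

definition sparse_word :: "nat \<Rightarrow> nat set \<Rightarrow> bool list" where
  "sparse_word n A = map (\<lambda>j. j \<in> Suc ` A) [0..<n]"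

lemma distinguishable_Q_iff:
  assumes "length x = length y"
  shows "distinguishable Q x y \<longleftrightarrow> rise_positions x \<noteq> rise_positions y"
proof -
  \<comment> \<open>Equal pairs are covered too: the set then collapses to a singleton, which is no
    edge.\<close>
  have "{(a, b), (c, d)} \<in> Q \<longleftrightarrow> (\<not> a \<and> b) \<noteq> (\<not> c \<and> d)" for a b c d
    by (cases a; cases b; cases c; cases d) (simp_all add: Q_def doubleton_eq_iff)
  then have "distinguishable Q x y \<longleftrightarrow> (\<exists>i. Suc i < length x \<and>
      (\<not> x ! i \<and> x ! Suc i) \<noteq> (\<not> y ! i \<and> y ! Suc i))"
    unfolding distinguishable_def by (simp only:)
  also have "\<dots> \<longleftrightarrow> rise_positions x \<noteq> rise_positions y"
    unfolding rise_positions_def set_eq_iff mem_Collect_eq assms by blast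
  finally show ?thesis .
qed

text \<open>Occurrences of 01 at \<open>i\<close> and \<open>Suc i\<close> would need the shared
  symbol to be both 1 and 0.\<close>

lemma rise_positions_in_sparse_sets:
  "rise_positions x \<in> sparse_sets (length x)"
  by (auto simp: rise_positions_def sparse_sets_def)

lemma rise_positions_sparse_word:
  assumes "A \<in> sparse_sets n"
  shows "rise_positions (sparse_word n A) = A"
proof -
  have "i \<in> rise_positions (sparse_word n A) \<longleftrightarrow> Suc i < n \<and> i \<notin> Suc ` A \<and> i \<in> A" for i
    by (cases "Suc i < n") (auto simp: rise_positions_def sparse_word_def nth_map[OF less_trans[OF lessI]])
  then show ?thesis
    using assms by (auto simp: sparse_sets_def)
qed

lemma finite_sparse_sets: "finite (sparse_sets n)"
  by (rule finite_subset[of _ "Pow {..<n}"]) (auto simp: sparse_sets_def)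

text \<open>Split by whether the largest admissible position \<open>n\<close> is used. If it is, its
  predecessor is excluded, so the remaining elements satisfy the bound for
  \<open>sparse_sets n\<close>.\<close>

lemma sparse_sets_Suc_Suc:
  "sparse_sets (Suc (Suc n)) = sparse_sets (Suc n) \<union> insert n ` sparse_sets n"
proof (intro equalityI subsetI)
  fix A assume A: "A \<in> sparse_sets (Suc (Suc n))"
  show "A \<in> sparse_sets (Suc n) \<union> insert n ` sparse_sets n"
  proof (cases "n \<in> A")
    case True
    have "Suc i < n" if "i \<in> A - {n}" for i
    proof -
      have "i \<noteq> n" "Suc i < Suc (Suc n)" "Suc i \<noteq> n"
        using A True that by (auto simp: sparse_sets_def)
      then show ?thesis by linarith
    qed
    then have "A - {n} \<in> sparse_sets n"
      using A by (auto simp: sparse_sets_def)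
    moreover have "A = insert n (A - {n})"
      using True by auto
    ultimately show ?thesis by blast
  next
    case False
    then have "A \<in> sparse_sets (Suc n)"
      using A by (fastforce simp: sparse_sets_def less_Suc_eq)
    then show ?thesis ..
  qed
qed (auto simp: sparse_sets_def)

text \<open>The splitting is the Fibonacci recursion. Lengths 0 and 1 both admit only the empty set,
  so the values start 1, 1, which fixes the index shift.\<close>

lemma card_sparse_sets: "card (sparse_sets n) = fib (Suc n)"
proof (induction n rule: fib.induct)
  case 1
  have "sparse_sets 0 = {{}}" by (auto simp: sparse_sets_def)
  then show ?case by simp
next
  case 2
  have "sparse_sets (Suc 0) = {{}}" by (auto simp: sparse_sets_def)
  then show ?case by simp
next
  case (3 n)
  have notin: "n \<notin> A" if "A \<in> sparse_sets n \<or> A \<in> sparse_sets (Suc n)" for A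
    using that by (auto simp: sparse_sets_def)
  then have "inj_on (insert n) (sparse_sets n)"
    by (meson inj_onI insert_ident)
  moreover have "sparse_sets (Suc n) \<inter> insert n ` sparse_sets n = {}"
    using notin by blast
  ultimately show ?case
    using 3 by (simp add: sparse_sets_Suc_Suc card_Un_disjoint finite_sparse_sets card_image)
qed

lemma max_distinguishable_Q: "max_distinguishable Q n = fib (Suc n)"
  unfolding max_distinguishable_def
proof (rule Max_eqI[OF finite_distinguishable_cards])
  fix m assume "m \<in> {card C | C. C \<subseteq> {x. length x = n} \<and> pairwise (distinguishable Q) C}"
  then obtain C where C: "m = card C" "C \<subseteq> {x. length x = n}" "pairwise (distinguishable Q) C"
    by blast
  \<comment> \<open>Upper bound: distinct words of a distinguishable set have distinct rise sets,
    all of them sparse.\<close>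
  have "inj_on rise_positions C"
    using C by (auto simp: inj_on_def pairwise_def subset_iff distinguishable_Q_iff)
  moreover have "rise_positions ` C \<subseteq> sparse_sets n"
    using C rise_positions_in_sparse_sets by fastforce
  ultimately show "m \<le> fib (Suc n)"
    using card_inj_on_le finite_sparse_sets C(1) by (metis card_sparse_sets)
next
  \<comment> \<open>Attaining the bound: one representative word for each sparse set.\<close>
  let ?C = "sparse_word n ` sparse_sets n"
  have "inj_on (sparse_word n) (sparse_sets n)"
    by (metis inj_onI rise_positions_sparse_word)
  then have "card ?C = fib (Suc n)"
    by (simp add: card_image card_sparse_sets)
  moreover have len: "length (sparse_word n A) = n" for A
    by (simp add: sparse_word_def)
  moreover have "pairwise (distinguishable Q) ?C"
    by (auto simp: pairwise_def len distinguishable_Q_iff rise_positions_sparse_word)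
  ultimately show "fib (Suc n) \<in> {card C | C. C \<subseteq> {x. length x = n} \<and> pairwise (distinguishable Q) C}"
    by (intro CollectI exI[of _ ?C]) auto
qed

text \<open>As \<open>\<phi> ^ 2 = \<phi> + 1\<close>, the powers of \<open>\<phi>\<close> obey the
  Fibonacci recursion, so both bounds propagate from \<open>n = 0\<close> and \<open>n = 1\<close>.
  The factor \<open>\<phi>\<close> is what the case \<open>n = 1\<close> requires.\<close>

lemma fib_golden_ratio_bounds:
  fixes \<phi> :: real
  defines "\<phi> \<equiv> (1 + sqrt 5) / 2"
  shows "\<phi> ^ n \<le> \<phi> * fib (Suc n) \<and> fib (Suc n) \<le> \<phi> ^ n"
proof (induction n rule: fib.induct)
  case 1
  show ?case by (simp add: \<phi>_def)
next
  case 2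
  show ?case by (simp add: \<phi>_def)
next
  case (3 n)
  have "\<phi> ^ 2 = \<phi> + 1"
    by (simp add: \<phi>_def power2_eq_square field_simps)
  then have "\<phi> ^ Suc (Suc n) = \<phi> ^ Suc n + \<phi> ^ n"
    by (metis add_2_eq_Suc distrib_right mult_1 power_Suc power_add)
  then show ?case
    using 3 by (simp add: distrib_left)
qed

text \<open>After taking logarithms and dividing by \<open>n\<close>, the constant factor
  \<open>\<phi>\<close> in the bounds costs only \<open>log 2 \<phi> / n\<close>, which vanishes in
  the limit.\<close>

lemma fib_log_growth:
  "(\<lambda>n. 1 / real n * log 2 (real (fib (Suc n)))) \<longlonglongrightarrow> log 2 ((1 + sqrt 5) / 2)"
proof -
  define \<phi> :: real where "\<phi> = (1 + sqrt 5) / 2"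
  have pos: "\<phi> > 0"
    by (simp add: \<phi>_def add_pos_pos)
  note bounds = fib_golden_ratio_bounds[folded \<phi>_def]
  have upper: "1 / real n * log 2 (real (fib (Suc n))) \<le> log 2 \<phi>"
    and lower: "log 2 \<phi> - log 2 \<phi> / real n \<le> 1 / real n * log 2 (real (fib (Suc n)))"
    if "n > 0" for n
  proof -
    have f: "real (fib (Suc n)) > 0"
      by (simp add: fib_neq_0_nat)
    have "log 2 (real (fib (Suc n))) \<le> log 2 (\<phi> ^ n)"
      using bounds f by (intro log_mono) auto
    then show "1 / real n * log 2 (real (fib (Suc n))) \<le> log 2 \<phi>"
      using that pos by (simp add: log_nat_power field_simps)
    have "log 2 (\<phi> ^ n) \<le> log 2 (\<phi> * real (fib (Suc n)))"
      using bounds pos by (intro log_mono) auto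
    then have "real n * log 2 \<phi> \<le> log 2 \<phi> + log 2 (real (fib (Suc n)))"
      using pos f by (simp only: log_nat_power log_mult_pos)
    then have "(real n * log 2 \<phi> - log 2 \<phi>) / real n \<le> log 2 (real (fib (Suc n))) / real n"
      by (intro divide_right_mono) auto
    then show "log 2 \<phi> - log 2 \<phi> / real n \<le> 1 / real n * log 2 (real (fib (Suc n)))"
      using that by (simp add: diff_divide_distrib)
  qed
  have "(\<lambda>n. log 2 \<phi> - log 2 \<phi> / real n) \<longlonglongrightarrow> log 2 \<phi> - 0"
    by (intro tendsto_diff tendsto_const lim_const_over_n)
  then have lim: "(\<lambda>n. log 2 \<phi> - log 2 \<phi> / real n) \<longlonglongrightarrow> log 2 \<phi>"
    by simp
  show ?thesis
    unfolding \<phi>_def[symmetric]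
    by (rule tendsto_sandwich[OF _ _ lim tendsto_const])
      (use upper lower in \<open>auto intro: eventually_sequentiallyI[of 1]\<close>)
qed

theorem theorem4:
  "shannon_markov_capacity Q = ereal (log 2 ((1 + sqrt 5) / 2))"
  unfolding shannon_markov_capacity_def max_distinguishable_Q
  \<comment> \<open>The sequence converges, so its limit superior is its limit; \<open>simp\<close>
    settles that the filter is nontrivial.\<close>
  by (intro lim_imp_Limsup tendsto_ereal fib_log_growth) simp

end
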